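(* Let $\mathcal B$ be a basis of a real Banach space $\mathbb X$ and let $w$ be a weight. Then $\mathcal B$ is $w$-partially-greedy if and only if $\mathcal B$ is quasi-greedy and $w$-conservative.
   Context: Basis: a Schauder basis $\mathcal B=(e_n)_{n=1}^\infty$ of a real Banach space $\mathbb X$ with biorthogonal functionals $(e_n^* )_{n=1}^\infty$ such that $0<\inf_n\min\{\|e_n\|,\|e_n^*\|\}\le\sup_n\max\{\|e_n\|,\|e_n^*\|\}<\infty$. For $x\in\mathbb X$, $\mathrm{supp}(x)=\{i\in\mathbb N: e_i^*(x)\neq0\}$. $\mathbb N^{<\infty}$ is the family of finite subsets of $\mathbb N$; $A<B$ means $\max A<\min B$. For finite $A$, $\mathbf 1_A=\sum_{n\in A}e_n$. A weight is a sequence $w=(w_i)_{i=1}^\infty\in(0,\infty)^{\mathbb N}$; $w(A)=\sum_{i\in A}w_i$. A greedy set of $x$ of cardinality $r\in\mathbb N$ is a set $A_r(x)\subset\mathrm{supp}(x)$ with $|A_r(x)|=r$ and $\min_{k\in A_r(x)}|e_k^*(x)|\ge\sup_{k\notin A_r(x)}|e_k^*(x)|$; the corresponding greedy approximand is $\mathcal G_r(x)=\sum_{k\in A_r(x)}e_k^*(x)e_k$. Inequalities involving $\mathcal G_r(x)$, $A_r(x)$ are required for every choice of greedy set. $\mathcal B$ is $w$-partially-greedy if there is a constant $C>0$ such that $\|x-\mathcal G_r(x)\|\le C\left\|\sum_{i=m+1}^\infty e_i^*(x)e_i\right\|$ for all $x\in\mathbb X$ and all $m,r\in\mathbb N$ with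 $w(\{1,\dots,m\})\le w(A_r(x))$. $\mathcal B$ is quasi-greedy if there is a constant $C$ with $\|x-\mathcal G_m(x)\|\le C\|x\|$ for all $x\in\mathbb X$, $m\in\mathbb N$. $\mathcal B$ is $w$-conservative if there is a constant $C>0$ with $\|\mathbf 1_A\|\le C\|\mathbf 1_B\|$ for all $A,B\in\mathbb N^{<\infty}$ with $A<B$ and $w(A)\le w(B)$. *)

theory Defs
  imports "HOL-Analysis.Analysis"
begin

text \<open>
  Indexing: the basis vectors e_1, e_2, ... of the literature are \<open>e 0\<close>, \<open>e 1\<close>, ... here, and
  likewise for the functionals and the weights.  Hence the index set \<open>{1, ..., m}\<close> of the
  literature is \<open>{..<m}\<close>, and a series starting at index \<open>m + 1\<close> there starts at index \<open>m\<close> here.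
  Cardinalities and the number \<open>m\<close> of removed terms are not shifted; as in the
  literature, where the natural numbers start at 1, they are required to be positive.
\<close>

definition schauder_basis :: "(nat \<Rightarrow> 'a::banach) \<Rightarrow> bool" where
  "schauder_basis e \<longleftrightarrow> (\<forall>x. \<exists>!a :: nat \<Rightarrow> real. (\<lambda>n. a n *\<^sub>R e n) sums x)"

definition biorthogonal :: "(nat \<Rightarrow> 'a::banach) \<Rightarrow> (nat \<Rightarrow> 'a \<Rightarrow>\<^sub>L real) \<Rightarrow> bool" where
  "biorthogonal e es \<longleftrightarrow> (\<forall>i j. blinfun_apply (es i) (e j) = (if i = j then 1 else 0))"

text \<open>
  The norm of \<open>es n\<close> is the operator norm.  The infimum is over a set bounded below by 0.
\<close>

definition is_basis :: "(nat \<Rightarrow> 'a::banach) \<Rightarrow> (nat \<Rightarrow> 'a \<Rightarrow>\<^sub>L real) \<Rightarrow> bool" where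
  "is_basis e es \<longleftrightarrow>
     schauder_basis e \<and> biorthogonal e es \<and>
     0 < (INF n. min (norm (e n)) (norm (es n))) \<and>
     bdd_above (range (\<lambda>n. max (norm (e n)) (norm (es n))))"

definition supp :: "(nat \<Rightarrow> 'a::banach \<Rightarrow>\<^sub>L real) \<Rightarrow> 'a \<Rightarrow> nat set" where
  "supp es x = {i. blinfun_apply (es i) x \<noteq> 0}"

definition is_weight :: "(nat \<Rightarrow> real) \<Rightarrow> bool" where
  "is_weight w \<longleftrightarrow> (\<forall>i. 0 < w i)"

text \<open>
  The last conjunct spells out that the minimum of the moduli of the coefficients over \<open>A\<close> is
  at least their supremum over the complement of \<open>A\<close>.
\<close>

definition greedy_set ::
    "(nat \<Rightarrow> 'a::banach \<Rightarrow>\<^sub>L real) \<Rightarrow> 'a \<Rightarrow> nat \<Rightarrow> nat set \<Rightarrow> bool" where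
  "greedy_set es x r A \<longleftrightarrow>
     A \<subseteq> supp es x \<and> finite A \<and> card A = r \<and>
     (\<forall>k\<in>A. \<forall>j. j \<notin> A \<longrightarrow> \<bar>blinfun_apply (es j) x\<bar> \<le> \<bar>blinfun_apply (es k) x\<bar>)"

definition greedy_approximand ::
    "(nat \<Rightarrow> 'a::banach) \<Rightarrow> (nat \<Rightarrow> 'a \<Rightarrow>\<^sub>L real) \<Rightarrow> 'a \<Rightarrow> nat set \<Rightarrow> 'a" where
  "greedy_approximand e es x A = (\<Sum>k\<in>A. blinfun_apply (es k) x *\<^sub>R e k)"

definition partially_greedy ::
    "(nat \<Rightarrow> real) \<Rightarrow> (nat \<Rightarrow> 'a::banach) \<Rightarrow> (nat \<Rightarrow> 'a \<Rightarrow>\<^sub>L real) \<Rightarrow> bool" where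
  "partially_greedy w e es \<longleftrightarrow>
     (\<exists>C>0. \<forall>x m r A. 1 \<le> m \<longrightarrow> 1 \<le> r \<longrightarrow> greedy_set es x r A \<longrightarrow> sum w {..<m} \<le> sum w A \<longrightarrow>
        norm (x - greedy_approximand e es x A)
          \<le> C * norm (\<Sum>i. blinfun_apply (es (i + m)) x *\<^sub>R e (i + m)))"

definition quasi_greedy :: "(nat \<Rightarrow> 'a::banach) \<Rightarrow> (nat \<Rightarrow> 'a \<Rightarrow>\<^sub>L real) \<Rightarrow> bool" where
  "quasi_greedy e es \<longleftrightarrow>
     (\<exists>C. \<forall>x m A. 1 \<le> m \<longrightarrow> greedy_set es x m A \<longrightarrow>
        norm (x - greedy_approximand e es x A) \<le> C * norm x)"

definition conservative :: "(nat \<Rightarrow> real) \<Rightarrow> (nat \<Rightarrow> 'a::banach) \<Rightarrow> bool" where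
  "conservative w e \<longleftrightarrow>
     (\<exists>C>0. \<forall>A B. finite A \<longrightarrow> finite B \<longrightarrow> (\<forall>a\<in>A. \<forall>b\<in>B. a < b) \<longrightarrow> sum w A \<le> sum w B \<longrightarrow>
        norm (sum e A) \<le> C * norm (sum e B))"

end

theory Submission
  imports Defs
begin

text \<open>
  Write \<open>P\<^sub>A x\<close> for the sum of the terms \<open>e\<^sub>k\<^sup>*(x) e\<^sub>k\<close> with \<open>k \<in> A\<close>.

  A partially greedy basis is quasi-greedy because enlarging the first coefficient of \<open>x\<close> turns
  every greedy set \<open>A\<close> of \<open>x\<close> into a greedy set containing the first index, whatever the weight
  is.  Such a set weighs at least as much as the initial segment of length one, and neither side
  of the resulting estimate sees the first coefficient.  The basis is conservative because for
  \<open>A < B\<close> one can test the estimate on the sum of all basis vectors up to \<open>max A\<close> and those of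
  \<open>B\<close>: all non-zero coefficients are equal, so the support minus \<open>A\<close> is a greedy set, the
  remainder is \<open>\<one>\<^sub>A\<close>, and the tail beyond \<open>max A\<close> is \<open>\<one>\<^sub>B\<close>.

  Conversely let \<open>A\<close> be a greedy set of \<open>x\<close> that weighs at least as much as
  \<open>D = {..<m}\<close>, and let \<open>y = x - P\<^sub>D x\<close> be the tail.  Then
  \<open>x - P\<^sub>A x = (y - P\<^sub>A\<^sub>-\<^sub>D y) + P\<^sub>D\<^sub>-\<^sub>A x\<close>.  The set \<open>A - D\<close> is greedy for \<open>y\<close>, so
  the first term is controlled by quasi-greediness.  For the second term let \<open>\<alpha>\<close> be the least
  modulus of a coefficient of \<open>y\<close> on \<open>A - D\<close>.  The coefficients of \<open>x\<close> on \<open>D - A\<close> are at most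
  \<open>\<alpha>\<close>, and \<open>D - A\<close> lies to the left of \<open>A - D\<close> and weighs no more, so conservativeness
  bounds \<open>P\<^sub>D\<^sub>-\<^sub>A x\<close> by a multiple of \<open>\<alpha> \<one>\<^sub>A\<^sub>-\<^sub>D\<close>.  That vector is in turn bounded by
  \<open>y\<close> for any quasi-greedy basis (\<open>quasi_greedy_with_truncation\<close> followed by
  \<open>quasi_greedy_with_remove_signs\<close>).  Passing between arbitrary and constant coefficients
  is in both places an instance of the layer-cake estimate \<open>norm_sum_layers\<close>.
\<close>

section \<open>Layer-cake estimates for finite sums\<close>

text \<open>
  A combination with coefficients in \<open>[0, b]\<close> is the integral over \<open>t \<in> [0, b]\<close> of the sums over the
  level sets \<open>{c > t}\<close>.  The induction peels off the lowest layer, whose height is the least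
  coefficient; what remains lives on a strictly smaller set.
\<close>

lemma norm_sum_layers:
  fixes v :: "'i \<Rightarrow> 'a::real_normed_vector"
  assumes "finite S" and "0 \<le> b" and "\<And>k. k \<in> S \<Longrightarrow> 0 \<le> c k \<and> c k \<le> b"
    and "\<And>t. norm (\<Sum>k\<in>{k\<in>S. t < c k}. v k) \<le> M"
  shows "norm (\<Sum>k\<in>S. c k *\<^sub>R v k) \<le> b * M"
  using assms
proof (induction "card S" arbitrary: S b c rule: less_induct)
  case less
  show ?case
  proof (cases "S = {}")
    case True
    have "0 \<le> M" using less.prems(4)[of 0] norm_ge_zero order_trans by blast
    with True \<open>0 \<le> b\<close> show ?thesis by simp
  next
    case False
    define s where "s = Min (c ` S)"
    have s_le: "s \<le> c k" if "k \<in> S" for k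
      using that \<open>finite S\<close> by (simp add: s_def)
    have "s \<in> c ` S" unfolding s_def using \<open>finite S\<close> False by (intro Min_in) auto
    then obtain k0 where k0: "k0 \<in> S" "c k0 = s" by auto
    define T where "T = {k\<in>S. s < c k}"
    have T: "T \<subseteq> S" "T \<subset> S" using k0 by (auto simp: T_def)
    have "card T < card S" using T \<open>finite S\<close> by (simp add: psubset_card_mono)
    moreover have "norm (\<Sum>k\<in>{k\<in>T. t < c k - s}. v k) \<le> M" for t
    proof -
      have "{k\<in>T. t < c k - s} = {k\<in>S. max s (s + t) < c k}" by (auto simp: T_def)
      then show ?thesis using less.prems(4) by metis
    qed
    moreover have "finite T" using T \<open>finite S\<close> finite_subset by blast
    moreover have "0 \<le> b - s" "\<And>k. k \<in> T \<Longrightarrow> 0 \<le> c k - s \<and> c k - s \<le> b - s"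
      using less.prems(3) k0 by (force simp: T_def)+
    ultimately have upper: "norm (\<Sum>k\<in>T. (c k - s) *\<^sub>R v k) \<le> (b - s) * M"
      using less.hyps[of T "b - s" "\<lambda>k. c k - s"] by simp
    have "{k\<in>S. s - 1 < c k} = S" using s_le by force
    then have bottom: "norm (\<Sum>k\<in>S. v k) \<le> M" using less.prems(4) by metis
    have "0 \<le> s" using less.prems(3) k0 by force
    have "(\<Sum>k\<in>S. c k *\<^sub>R v k) = (\<Sum>k\<in>S. s *\<^sub>R v k + (c k - s) *\<^sub>R v k)"
      by (simp add: scaleR_left_diff_distrib)
    also have "\<dots> = s *\<^sub>R (\<Sum>k\<in>S. v k) + (\<Sum>k\<in>S. (c k - s) *\<^sub>R v k)"
      by (simp add: sum.distrib scaleR_sum_right)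
    also have "(\<Sum>k\<in>S. (c k - s) *\<^sub>R v k) = (\<Sum>k\<in>T. (c k - s) *\<^sub>R v k)"
      using T s_le \<open>finite S\<close> by (intro sum.mono_neutral_right) (force simp: T_def)+
    finally have decomposition: "(\<Sum>k\<in>S. c k *\<^sub>R v k)
        = s *\<^sub>R (\<Sum>k\<in>S. v k) + (\<Sum>k\<in>T. (c k - s) *\<^sub>R v k)" .
    have "norm (\<Sum>k\<in>S. c k *\<^sub>R v k)
        \<le> s * norm (\<Sum>k\<in>S. v k) + norm (\<Sum>k\<in>T. (c k - s) *\<^sub>R v k)"
      unfolding decomposition using \<open>0 \<le> s\<close>
      by (intro order_trans[OF norm_triangle_ineq]) simp
    also have "\<dots> \<le> s * M + (b - s) * M"
      using upper bottom \<open>0 \<le> s\<close> by (intro add_mono mult_left_mono) auto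
    finally show ?thesis by (simp add: algebra_simps)
  qed
qed

lemma norm_sum_bounded_coefficients:
  fixes v :: "'i \<Rightarrow> 'a::real_normed_vector"
  assumes "finite S" and "0 \<le> b" and "\<And>k. k \<in> S \<Longrightarrow> \<bar>c k\<bar> \<le> b"
    and "\<And>F. F \<subseteq> S \<Longrightarrow> norm (\<Sum>k\<in>F. v k) \<le> M"
  shows "norm (\<Sum>k\<in>S. c k *\<^sub>R v k) \<le> 2 * b * M"
proof -
  have pos: "norm (\<Sum>k\<in>S. max (c k) 0 *\<^sub>R v k) \<le> b * M"
    using assms by (intro norm_sum_layers) (auto simp: abs_le_iff)
  have neg: "norm (\<Sum>k\<in>S. max (- c k) 0 *\<^sub>R v k) \<le> b * M"
    using assms by (intro norm_sum_layers) (auto simp: abs_le_iff)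
  have "(\<Sum>k\<in>S. c k *\<^sub>R v k)
      = (\<Sum>k\<in>S. max (c k) 0 *\<^sub>R v k) - (\<Sum>k\<in>S. max (- c k) 0 *\<^sub>R v k)"
    unfolding sum_subtractf[symmetric] scaleR_left_diff_distrib[symmetric]
    by (intro sum.cong) auto
  then have "norm (\<Sum>k\<in>S. c k *\<^sub>R v k) \<le> norm (\<Sum>k\<in>S. max (c k) 0 *\<^sub>R v k)
      + norm (\<Sum>k\<in>S. max (- c k) 0 *\<^sub>R v k)"
    using norm_triangle_ineq4 by simp
  then show ?thesis using pos neg by simp
qed

section \<open>Coefficients and expansions\<close>

lemma biorthogonal_apply_sum:
  assumes "biorthogonal e es" and "finite A"
  shows "blinfun_apply (es j) (\<Sum>k\<in>A. c k *\<^sub>R e k) = (if j \<in> A then c j else 0)"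
  using assms by (simp add: biorthogonal_def blinfun.sum_right blinfun.scaleR_right
    if_distrib[of "(*) _"] cong: if_cong)

lemma apply_greedy_approximand:
  assumes "biorthogonal e es" and "finite A"
  shows "blinfun_apply (es j) (greedy_approximand e es x A)
      = (if j \<in> A then blinfun_apply (es j) x else 0)"
  unfolding greedy_approximand_def using biorthogonal_apply_sum[OF assms] by simp

lemma greedy_approximand_Un_disjoint:
  assumes "finite A" "finite B" "A \<inter> B = {}"
  shows "greedy_approximand e es x (A \<union> B)
      = greedy_approximand e es x A + greedy_approximand e es x B"
  unfolding greedy_approximand_def using assms by (rule sum.union_disjoint)

lemma greedy_approximand_diff:
  assumes "finite A" "B \<subseteq> A"
  shows "greedy_approximand e es x (A - B)
      = greedy_approximand e es x A - greedy_approximand e es x B"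
  unfolding greedy_approximand_def using assms by (rule sum_diff)

lemma basis_expansion_sums:
  assumes "schauder_basis e" and "biorthogonal e es"
  shows "(\<lambda>n. blinfun_apply (es n) x *\<^sub>R e n) sums x"
proof -
  obtain a where a: "(\<lambda>n. a n *\<^sub>R e n) sums x"
    using assms(1) unfolding schauder_basis_def by blast
  have "a j = blinfun_apply (es j) x" for j
  proof -
    have "(\<lambda>n. blinfun_apply (es j) (a n *\<^sub>R e n)) sums blinfun_apply (es j) x"
      using bounded_linear.sums[OF blinfun.bounded_linear_right a] .
    moreover have "(\<lambda>n. blinfun_apply (es j) (a n *\<^sub>R e n)) = (\<lambda>n. if n = j then a n else 0)"
      using assms(2) by (auto simp: biorthogonal_def blinfun.scaleR_right)
    ultimately show ?thesis using sums_single[of j a] sums_unique2 by metis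
  qed
  with a show ?thesis by simp
qed

lemma basis_expansion_tail:
  assumes "schauder_basis e" and "biorthogonal e es"
  shows "(\<Sum>i. blinfun_apply (es (i + m)) x *\<^sub>R e (i + m))
      = x - greedy_approximand e es x {..<m}"
  using sums_unique[OF sums_split_initial_segment[OF basis_expansion_sums[OF assms], of m x]]
  by (simp add: greedy_approximand_def)

section \<open>Constant coefficients in quasi-greedy bases\<close>

text \<open>
  In contrast to the quasi-greedy inequality itself, the empty greedy set is included here, so
  that the sum over the difference of two nested greedy sets has norm at most
  \<open>2 * K * norm x\<close> even if the smaller one is empty.
\<close>

definition quasi_greedy_with ::
    "real \<Rightarrow> (nat \<Rightarrow> 'a::banach) \<Rightarrow> (nat \<Rightarrow> 'a \<Rightarrow>\<^sub>L real) \<Rightarrow> bool" where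
  "quasi_greedy_with K e es \<longleftrightarrow>
     (\<forall>x r A. greedy_set es x r A \<longrightarrow> norm (x - greedy_approximand e es x A) \<le> K * norm x)"

lemma quasi_greedy_with_bound:
  "quasi_greedy_with K e es \<Longrightarrow> greedy_set es x r A \<Longrightarrow>
    norm (x - greedy_approximand e es x A) \<le> K * norm x"
  unfolding quasi_greedy_with_def by blast

lemma quasi_greedy_imp_with:
  assumes "quasi_greedy e es"
  obtains K where "1 \<le> K" "quasi_greedy_with K e es"
proof -
  obtain C where C: "\<And>x m A. 1 \<le> m \<Longrightarrow> greedy_set es x m A \<Longrightarrow>
      norm (x - greedy_approximand e es x A) \<le> C * norm x"
    using assms unfolding quasi_greedy_def by blast
  have "norm (x - greedy_approximand e es x A) \<le> max C 1 * norm x"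
    if A: "greedy_set es x r A" for x r A
  proof (cases "r = 0")
    case True
    then have "A = {}" using A by (auto simp: greedy_set_def)
    then show ?thesis using mult_right_mono[of 1 "max C 1" "norm x"] by (simp add: greedy_approximand_def)
  next
    case False
    then have "norm (x - greedy_approximand e es x A) \<le> C * norm x"
      using A by (intro C) auto
    also have "\<dots> \<le> max C 1 * norm x" by (intro mult_right_mono) auto
    finally show ?thesis .
  qed
  then show ?thesis using that[of "max C 1"] by (simp add: quasi_greedy_with_def)
qed

text \<open>
  With \<open>a\<close> the coefficients of \<open>y\<close>, the vector on the left is the combination of the terms
  \<open>a\<^sub>k e\<^sub>k\<close> with coefficients \<open>\<alpha> / \<bar>a\<^sub>k\<bar> \<le> 1\<close>.  The level sets of these coefficients are
  differences of two greedy sets, because dividing by \<open>\<bar>a\<^sub>k\<bar>\<close> reverses the order of the moduli.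
\<close>

lemma quasi_greedy_with_truncation:
  assumes qg: "quasi_greedy_with K e es"
    and A: "greedy_set es y r A" and "0 < \<alpha>"
    and \<alpha>: "\<And>k. k \<in> A \<Longrightarrow> \<alpha> \<le> \<bar>blinfun_apply (es k) y\<bar>"
  shows "\<alpha> * norm (\<Sum>k\<in>A. sgn (blinfun_apply (es k) y) *\<^sub>R e k) \<le> 2 * K * norm y"
proof -
  define a where "a = (\<lambda>k. blinfun_apply (es k) y)"
  have fin: "finite A" and nz: "\<And>k. k \<in> A \<Longrightarrow> a k \<noteq> 0"
    and larger: "\<And>k j. k \<in> A \<Longrightarrow> j \<notin> A \<Longrightarrow> \<bar>a j\<bar> \<le> \<bar>a k\<bar>"
    using A by (auto simp: greedy_set_def supp_def a_def)
  have level: "norm (\<Sum>k\<in>{k\<in>A. t < \<alpha> / \<bar>a k\<bar>}. a k *\<^sub>R e k) \<le> 2 * K * norm y" for t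
  proof -
    define B where "B = {k\<in>A. \<alpha> / \<bar>a k\<bar> \<le> t}"
    have reverse: "\<bar>a j\<bar> \<le> \<bar>a k\<bar>" if "k \<in> B" "j \<in> A" "j \<notin> B" for j k
    proof -
      have "\<alpha> / \<bar>a k\<bar> < \<alpha> / \<bar>a j\<bar>" using that by (auto simp: B_def)
      moreover have "0 < \<bar>a k\<bar>" "0 < \<bar>a j\<bar>" using that nz by (auto simp: B_def)
      ultimately show ?thesis using \<open>0 < \<alpha>\<close> by (simp add: divide_simps mult_less_cancel_left)
    qed
    have "B \<subseteq> A" by (auto simp: B_def)
    moreover have "\<bar>a j\<bar> \<le> \<bar>a k\<bar>" if "k \<in> B" "j \<notin> B" for j k
      using that reverse larger \<open>B \<subseteq> A\<close> by blast
    ultimately have B: "greedy_set es y (card B) B"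
      using fin nz finite_subset by (fastforce simp: greedy_set_def supp_def a_def)
    have "{k\<in>A. t < \<alpha> / \<bar>a k\<bar>} = A - B" by (auto simp: B_def)
    then have "(\<Sum>k\<in>{k\<in>A. t < \<alpha> / \<bar>a k\<bar>}. a k *\<^sub>R e k)
        = (y - greedy_approximand e es y B) - (y - greedy_approximand e es y A)"
      using greedy_approximand_diff[OF fin \<open>B \<subseteq> A\<close>, of e es y]
      by (simp add: greedy_approximand_def a_def)
    also have "norm \<dots> \<le> K * norm y + K * norm y"
      using quasi_greedy_with_bound[OF qg A] quasi_greedy_with_bound[OF qg B]
      by (intro order_trans[OF norm_triangle_ineq4]) auto
    finally show ?thesis by simp
  qed
  have "norm (\<Sum>k\<in>A. (\<alpha> / \<bar>a k\<bar>) *\<^sub>R (a k *\<^sub>R e k)) \<le> 1 * (2 * K * norm y)"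
  proof (rule norm_sum_layers[OF fin _ _ level])
    show "0 \<le> \<alpha> / \<bar>a k\<bar> \<and> \<alpha> / \<bar>a k\<bar> \<le> 1" if "k \<in> A" for k
      using \<alpha>[OF that] \<open>0 < \<alpha>\<close> by (simp add: a_def divide_le_eq)
  qed simp
  moreover have "(\<Sum>k\<in>A. (\<alpha> / \<bar>a k\<bar>) *\<^sub>R (a k *\<^sub>R e k)) = \<alpha> *\<^sub>R (\<Sum>k\<in>A. sgn (a k) *\<^sub>R e k)"
    unfolding scaleR_sum_right by (intro sum.cong) (auto simp: sgn_real_def)
  ultimately show ?thesis using \<open>0 < \<alpha>\<close> by (simp add: a_def)
qed

text \<open>
  All non-zero coefficients of the signed sum have modulus one, so each subset of \<open>A\<close> is a greedy
  set of it, in particular the set of positive signs and its complement in \<open>A\<close>.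
\<close>

lemma quasi_greedy_with_remove_signs:
  assumes qg: "quasi_greedy_with K e es" and bi: "biorthogonal e es"
    and fin: "finite A" and s: "\<And>k. k \<in> A \<Longrightarrow> \<bar>s k\<bar> = 1"
  shows "norm (\<Sum>k\<in>A. e k) \<le> 2 * K * norm (\<Sum>k\<in>A. s k *\<^sub>R e k)"
proof -
  define z where "z = (\<Sum>k\<in>A. s k *\<^sub>R e k)"
  have coeff: "blinfun_apply (es j) z = (if j \<in> A then s j else 0)" for j
    unfolding z_def by (rule biorthogonal_apply_sum[OF bi fin])
  have part: "norm (\<Sum>k\<in>A - F. s k *\<^sub>R e k) \<le> K * norm z" if "F \<subseteq> A" for F
  proof -
    have "s k \<noteq> 0" if "k \<in> A" for k using s[OF that] by auto
    then have "greedy_set es z (card F) F"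
      using that fin finite_subset s by (fastforce simp: greedy_set_def supp_def coeff)
    moreover have "greedy_approximand e es z F = (\<Sum>k\<in>F. s k *\<^sub>R e k)"
      unfolding greedy_approximand_def using that by (intro sum.cong) (auto simp: coeff)
    ultimately have "norm (z - (\<Sum>k\<in>F. s k *\<^sub>R e k)) \<le> K * norm z"
      using quasi_greedy_with_bound[OF qg] by metis
    then show ?thesis using that fin by (simp add: sum_diff z_def)
  qed
  define N where "N = {k\<in>A. s k < 0}"
  define Q where "Q = {k\<in>A. \<not> s k < 0}"
  have "A - N = Q" "A - Q = N" "N \<subseteq> A" "Q \<subseteq> A" by (auto simp: N_def Q_def)
  have "(\<Sum>k\<in>A. e k) = (\<Sum>k\<in>Q. e k) + (\<Sum>k\<in>N. e k)"
    using fin \<open>A - Q = N\<close> \<open>Q \<subseteq> A\<close> by (metis add.commute sum.subset_diff)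
  also have "(\<Sum>k\<in>Q. e k) = (\<Sum>k\<in>Q. s k *\<^sub>R e k)"
    using s by (intro sum.cong) (fastforce simp: Q_def abs_if)+
  also have "(\<Sum>k\<in>N. e k) = - (\<Sum>k\<in>N. s k *\<^sub>R e k)"
    unfolding sum_negf[symmetric]
  proof (intro sum.cong refl)
    show "e k = - (s k *\<^sub>R e k)" if "k \<in> N" for k
    proof -
      have "s k = -1" using that s[of k] by (auto simp: N_def)
      then show ?thesis by simp
    qed
  qed
  finally have "norm (\<Sum>k\<in>A. e k) \<le> norm (\<Sum>k\<in>Q. s k *\<^sub>R e k) + norm (\<Sum>k\<in>N. s k *\<^sub>R e k)"
    using norm_triangle_ineq4 by simp
  also have "\<dots> \<le> K * norm z + K * norm z"
    using part[OF \<open>N \<subseteq> A\<close>] part[OF \<open>Q \<subseteq> A\<close>] \<open>A - N = Q\<close> \<open>A - Q = N\<close> by simp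
  finally show ?thesis by (simp add: z_def)
qed

section \<open>Partially greedy bases\<close>

lemma partially_greedy_obtain:
  assumes "partially_greedy w e es" and "schauder_basis e" and "biorthogonal e es"
  obtains C where "0 < C"
    and "\<And>x m r A. 1 \<le> m \<Longrightarrow> 1 \<le> r \<Longrightarrow> greedy_set es x r A \<Longrightarrow> sum w {..<m} \<le> sum w A \<Longrightarrow>
      norm (x - greedy_approximand e es x A)
        \<le> C * norm (x - greedy_approximand e es x {..<m})"
  using assms(1) unfolding partially_greedy_def basis_expansion_tail[OF assms(2,3)] by blast

text \<open>
  A greedy set \<open>A\<close> that is light compared with the first weight admits no initial segment at all in
  the partially greedy inequality.  Raising the first coefficient to a value that dominates
  all others puts the index \<open>0\<close> into a greedy set and makes the segment of length one
  admissible.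
\<close>

lemma partially_greedy_imp_quasi_greedy:
  assumes pg: "partially_greedy w e es" and sb: "schauder_basis e" and bi: "biorthogonal e es"
    and w: "is_weight w"
  shows "quasi_greedy e es"
proof -
  obtain C where "0 < C" and C: "\<And>x m r A. 1 \<le> m \<Longrightarrow> 1 \<le> r \<Longrightarrow> greedy_set es x r A \<Longrightarrow>
      sum w {..<m} \<le> sum w A \<Longrightarrow>
      norm (x - greedy_approximand e es x A) \<le> C * norm (x - greedy_approximand e es x {..<m})"
    using partially_greedy_obtain[OF pg sb bi] by blast
  define H where "H = norm (es 0) * norm (e 0)"
  have "norm (x - greedy_approximand e es x A) \<le> (H + C * (1 + H)) * norm x"
    if "1 \<le> r" and A: "greedy_set es x r A" for x r A
  proof -
    define a where "a = (\<lambda>k. blinfun_apply (es k) x)"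
    have fin: "finite A" and nz: "\<And>k. k \<in> A \<Longrightarrow> a k \<noteq> 0" and "card A = r"
      and larger: "\<And>k j. k \<in> A \<Longrightarrow> j \<notin> A \<Longrightarrow> \<bar>a j\<bar> \<le> \<bar>a k\<bar>"
      using A by (auto simp: greedy_set_def supp_def a_def)
    \<comment> \<open>Moduli outside \<open>A\<close> are bounded by those on \<open>A\<close>, so \<open>L\<close> exceeds every coefficient.\<close>
    define L where "L = 1 + (\<Sum>k\<in>A. \<bar>a k\<bar>)"
    have in_A: "\<bar>a j\<bar> \<le> (\<Sum>k\<in>A. \<bar>a k\<bar>)" if "j \<in> A" for j
      using fin that by (intro member_le_sum) auto
    have "A \<noteq> {}" using \<open>1 \<le> r\<close> \<open>card A = r\<close> by auto
    then obtain k0 where "k0 \<in> A" by auto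
    then have L: "\<bar>a j\<bar> \<le> L" for j
      using in_A[of j] in_A[of k0] larger[of k0 j] by (cases "j \<in> A") (auto simp: L_def)
    have "0 < L" unfolding L_def by (intro add_pos_nonneg sum_nonneg) auto
    define z where "z = x + (L - a 0) *\<^sub>R e 0"
    have coeff: "blinfun_apply (es j) z = (if j = 0 then L else a j)" for j
      using bi by (simp add: z_def biorthogonal_def blinfun.add_right blinfun.scaleR_right a_def)
    define B where "B = insert 0 A"
    have B: "greedy_set es z (card B) B"
      unfolding greedy_set_def
    proof (intro conjI ballI allI impI)
      show "B \<subseteq> supp es z" using nz \<open>0 < L\<close> by (auto simp: B_def supp_def coeff)
      show "finite B" using fin by (simp add: B_def)
      show "\<bar>blinfun_apply (es j) z\<bar> \<le> \<bar>blinfun_apply (es k) z\<bar>" if "k \<in> B" "j \<notin> B" for j k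
        using that larger[of k j] L[of j] by (auto simp: coeff B_def split: if_splits)
    qed simp
    have "finite B" using fin by (simp add: B_def)
    have "1 \<le> card B" using \<open>finite B\<close> by (simp add: B_def Suc_le_eq card_gt_0_iff)
    moreover have "sum w {..<1} \<le> sum w B"
      using w \<open>finite B\<close> by (intro sum_mono2) (auto simp: B_def is_weight_def less_imp_le)
    ultimately have *: "norm (z - greedy_approximand e es z B)
        \<le> C * norm (z - greedy_approximand e es z {..<1})"
      using C[OF _ _ B, of 1] by simp
    have "greedy_approximand e es z {..<1} = L *\<^sub>R e 0"
      by (simp add: greedy_approximand_def coeff)
    then have tail: "z - greedy_approximand e es z {..<1} = x - a 0 *\<^sub>R e 0"
      by (simp add: z_def algebra_simps)
    have "greedy_approximand e es z B = L *\<^sub>R e 0 + greedy_approximand e es x (A - {0})"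
      using fin by (simp add: greedy_approximand_def B_def sum.insert_remove coeff a_def)
    then have rest: "z - greedy_approximand e es z B
        = x - a 0 *\<^sub>R e 0 - greedy_approximand e es x (A - {0})"
      by (simp add: z_def algebra_simps)
    have first: "norm (a 0 *\<^sub>R e 0) \<le> H * norm x"
      using mult_right_mono[OF norm_blinfun[of "es 0" x] norm_ge_zero[of "e 0"]]
      by (simp add: a_def H_def mult_ac)
    have "norm (x - greedy_approximand e es x A) \<le> H * norm x + norm (z - greedy_approximand e es z B)"
    proof (cases "0 \<in> A")
      case True
      have "greedy_approximand e es x A = a 0 *\<^sub>R e 0 + greedy_approximand e es x (A - {0})"
        using True fin by (simp add: greedy_approximand_def sum.remove a_def)
      then have "x - greedy_approximand e es x A = z - greedy_approximand e es z B"
        by (simp add: rest)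
      then show ?thesis by (simp add: H_def)
    next
      case False
      then have "x - greedy_approximand e es x A = a 0 *\<^sub>R e 0 + (z - greedy_approximand e es z B)"
        by (simp add: rest)
      then show ?thesis using first norm_triangle_ineq by (smt (verit))
    qed
    also have "\<dots> \<le> H * norm x + C * norm (x - a 0 *\<^sub>R e 0)" using * tail by simp
    also have "\<dots> \<le> H * norm x + C * (norm x + H * norm x)"
      using first \<open>0 < C\<close> norm_triangle_ineq4[of x "a 0 *\<^sub>R e 0"] by simp
    finally show ?thesis by (simp add: algebra_simps)
  qed
  then show ?thesis unfolding quasi_greedy_def by blast
qed

lemma partially_greedy_imp_conservative:
  assumes pg: "partially_greedy w e es" and sb: "schauder_basis e" and bi: "biorthogonal e es"
    and w: "is_weight w"
  shows "conservative w e"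
proof -
  obtain C where "0 < C" and C: "\<And>x m r A. 1 \<le> m \<Longrightarrow> 1 \<le> r \<Longrightarrow> greedy_set es x r A \<Longrightarrow>
      sum w {..<m} \<le> sum w A \<Longrightarrow>
      norm (x - greedy_approximand e es x A) \<le> C * norm (x - greedy_approximand e es x {..<m})"
    using partially_greedy_obtain[OF pg sb bi] by blast
  have "norm (sum e A) \<le> C * norm (sum e B)"
    if fin: "finite A" "finite B" and AB: "\<forall>a\<in>A. \<forall>b\<in>B. a < b" and wAB: "sum w A \<le> sum w B" for A B
  proof (cases "A = {}")
    case True
    then show ?thesis using \<open>0 < C\<close> by simp
  next
    case False
    have "0 < sum w A" using w False fin by (intro sum_pos) (auto simp: is_weight_def)
    then have "B \<noteq> {}" using wAB by auto
    define D where "D = {..<Suc (Max A)}"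
    have "A \<subseteq> D" using fin by (auto simp: D_def less_Suc_eq_le)
    have DB: "D \<inter> B = {}" using AB Max_in[OF fin(1) False] by (fastforce simp: D_def less_Suc_eq_le)
    define x where "x = (\<Sum>k\<in>D \<union> B. 1 *\<^sub>R e k)"
    have "finite D" by (simp add: D_def)
    have coeff: "blinfun_apply (es j) x = (if j \<in> D \<union> B then 1 else 0)" for j
      unfolding x_def using fin \<open>finite D\<close> by (intro biorthogonal_apply_sum[OF bi]) auto
    define G where "G = (D - A) \<union> B"
    have G: "greedy_set es x (card G) G"
      using fin \<open>finite D\<close> by (auto simp: greedy_set_def supp_def coeff G_def)
    have ones: "greedy_approximand e es x F = sum e F" if "F \<subseteq> D \<union> B" for F
      unfolding greedy_approximand_def using that by (intro sum.cong) (auto simp: coeff)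
    have "sum w G = sum w (D - A) + sum w B"
      unfolding G_def using fin \<open>finite D\<close> DB by (intro sum.union_disjoint) auto
    also have "sum w (D - A) = sum w D - sum w A"
      using \<open>finite D\<close> \<open>A \<subseteq> D\<close> by (rule sum_diff)
    finally have "sum w D \<le> sum w G" using wAB by simp
    moreover have "1 \<le> card G"
      using \<open>B \<noteq> {}\<close> fin \<open>finite D\<close> by (simp add: G_def Suc_le_eq card_gt_0_iff)
    ultimately have "norm (x - greedy_approximand e es x G)
        \<le> C * norm (x - greedy_approximand e es x D)"
      using C[OF _ _ G, of "Suc (Max A)"] by (simp add: D_def)
    moreover have "x - greedy_approximand e es x G = sum e A"
    proof -
      have "D \<union> B - G = A" using \<open>A \<subseteq> D\<close> DB unfolding G_def by blast
      moreover have "sum e (D \<union> B - G) = sum e (D \<union> B) - sum e G"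
        using fin \<open>finite D\<close> by (intro sum_diff) (auto simp: G_def)
      ultimately show ?thesis using ones[of G] by (auto simp: x_def G_def)
    qed
    moreover have "x - greedy_approximand e es x D = sum e B"
      using ones[of D] fin \<open>finite D\<close> DB by (simp add: x_def sum.union_disjoint)
    ultimately show ?thesis by simp
  qed
  then show ?thesis unfolding conservative_def using \<open>0 < C\<close> by blast
qed

text \<open>
  The removed initial segment \<open>D\<close> and the greedy set \<open>A\<close> interact only through \<open>D - A\<close> and
  \<open>A - D\<close>: cancelling the common part of the weights gives \<open>w(D - A) \<le> w(A - D)\<close>, which
  is what conservativeness asks for, and it passes to all subsets of \<open>D - A\<close>.
\<close>

lemma quasi_greedy_conservative_imp_partially_greedy:
  assumes qg: "quasi_greedy e es" and cons: "conservative w e"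
    and sb: "schauder_basis e" and bi: "biorthogonal e es" and w: "is_weight w"
  shows "partially_greedy w e es"
proof -
  obtain K where "1 \<le> K" and K: "quasi_greedy_with K e es"
    using quasi_greedy_imp_with[OF qg] .
  obtain C where "0 < C" and C: "\<And>A B. finite A \<Longrightarrow> finite B \<Longrightarrow> (\<forall>a\<in>A. \<forall>b\<in>B. a < b) \<Longrightarrow>
      sum w A \<le> sum w B \<Longrightarrow> norm (sum e A) \<le> C * norm (sum e B)"
    using cons unfolding conservative_def by blast
  have "norm (x - greedy_approximand e es x A)
      \<le> (K + 8 * C * K * K) * norm (x - greedy_approximand e es x {..<m})"
    if A: "greedy_set es x r A" and wm: "sum w {..<m} \<le> sum w A" for x m r A
  proof -
    define D where "D = {..<m}"
    define y where "y = x - greedy_approximand e es x D"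
    have fin: "finite A" "finite D" using A by (auto simp: greedy_set_def D_def)
    have coeff: "blinfun_apply (es j) y = (if j \<in> D then 0 else blinfun_apply (es j) x)" for j
      by (simp add: y_def blinfun.diff_right apply_greedy_approximand[OF bi fin(2)])
    have AD: "greedy_set es y (card (A - D)) (A - D)"
      using A by (auto simp: greedy_set_def supp_def coeff)
    have split: "x - greedy_approximand e es x A
        = (y - greedy_approximand e es y (A - D)) + greedy_approximand e es x (D - A)"
    proof -
      have "greedy_approximand e es y (A - D) = greedy_approximand e es x (A - D)"
        unfolding greedy_approximand_def by (intro sum.cong) (auto simp: coeff)
      moreover have "greedy_approximand e es x A + greedy_approximand e es x (D - A)
          = greedy_approximand e es x D + greedy_approximand e es x (A - D)"
        using greedy_approximand_Un_disjoint[of A "D - A" e es x]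
          greedy_approximand_Un_disjoint[of D "A - D" e es x] fin by (simp add: Un_commute)
      ultimately show ?thesis by (simp add: y_def algebra_simps)
    qed
    have weights: "sum w (D - A) \<le> sum w (A - D)"
      using wm sum.Int_Diff[OF fin(1), of w D] sum.Int_Diff[OF fin(2), of w A]
      by (simp add: D_def Int_commute)
    have left: "norm (greedy_approximand e es x (D - A)) \<le> 8 * C * K * K * norm y"
    proof (cases "A - D = {}")
      case True
      have "\<not> 0 < sum w (D - A)" using weights True by simp
      then have "D - A = {}"
        using w fin sum_pos[of "D - A" w] by (auto simp: is_weight_def)
      then show ?thesis using \<open>0 < C\<close> \<open>1 \<le> K\<close> by (simp only: greedy_approximand_def) simp
    next
      case False
      define \<alpha> where "\<alpha> = Min ((\<lambda>k. \<bar>blinfun_apply (es k) y\<bar>) ` (A - D))"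
      have \<alpha>_le: "\<alpha> \<le> \<bar>blinfun_apply (es k) y\<bar>" if "k \<in> A - D" for k
        using that fin by (simp add: \<alpha>_def)
      have "\<alpha> \<in> (\<lambda>k. \<bar>blinfun_apply (es k) y\<bar>) ` (A - D)"
        unfolding \<alpha>_def using fin False by (intro Min_in) auto
      then obtain k0 where k0: "k0 \<in> A" "k0 \<notin> D" "\<alpha> = \<bar>blinfun_apply (es k0) x\<bar>"
        by (auto simp: coeff)
      have "0 < \<alpha>" using k0 A by (auto simp: greedy_set_def supp_def)
      have small: "\<bar>blinfun_apply (es j) x\<bar> \<le> \<alpha>" if "j \<in> D - A" for j
        using that k0 A by (auto simp: greedy_set_def)
      have "norm (\<Sum>k\<in>F. e k) \<le> C * norm (\<Sum>k\<in>A - D. e k)" if "F \<subseteq> D - A" for F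
      proof (rule C)
        have "sum w F \<le> sum w (D - A)"
          using that fin w by (intro sum_mono2) (auto simp: is_weight_def less_imp_le)
        then show "sum w F \<le> sum w (A - D)" using weights by simp
        show "finite F" using that fin finite_subset by blast
        show "\<forall>a\<in>F. \<forall>b\<in>A - D. a < b" using that by (force simp: D_def)
      qed (use fin in simp)
      then have "norm (greedy_approximand e es x (D - A))
          \<le> 2 * \<alpha> * (C * norm (\<Sum>k\<in>A - D. e k))"
        unfolding greedy_approximand_def using fin \<open>0 < \<alpha>\<close> small
        by (intro norm_sum_bounded_coefficients) auto
      also have "norm (\<Sum>k\<in>A - D. e k)
          \<le> 2 * K * norm (\<Sum>k\<in>A - D. sgn (blinfun_apply (es k) y) *\<^sub>R e k)"
        using AD fin by (intro quasi_greedy_with_remove_signs[OF K bi])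
          (auto simp: greedy_set_def supp_def abs_sgn_eq)
      finally have "norm (greedy_approximand e es x (D - A))
          \<le> 4 * C * K * (\<alpha> * norm (\<Sum>k\<in>A - D. sgn (blinfun_apply (es k) y) *\<^sub>R e k))"
        using \<open>0 < C\<close> \<open>0 < \<alpha>\<close> by (simp add: mult_ac)
      also have "\<dots> \<le> 4 * C * K * (2 * K * norm y)"
        using quasi_greedy_with_truncation[OF K AD \<open>0 < \<alpha>\<close> \<alpha>_le] \<open>0 < C\<close> \<open>1 \<le> K\<close>
        by (intro mult_left_mono) auto
      finally show ?thesis by (simp add: mult_ac)
    qed
    have "norm (x - greedy_approximand e es x A) \<le> K * norm y + 8 * C * K * K * norm y"
      unfolding split using quasi_greedy_with_bound[OF K AD] left
      by (intro order_trans[OF norm_triangle_ineq] add_mono)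
    then show ?thesis by (simp add: y_def D_def algebra_simps)
  qed
  moreover have "0 < K + 8 * C * K * K" using \<open>0 < C\<close> \<open>1 \<le> K\<close> by (simp add: add_pos_pos)
  ultimately show ?thesis
    unfolding partially_greedy_def basis_expansion_tail[OF sb bi] by blast
qed

theorem theorem5p7:
  fixes e :: "nat \<Rightarrow> 'a::banach"
    and es :: "nat \<Rightarrow> 'a \<Rightarrow>\<^sub>L real"
    and w :: "nat \<Rightarrow> real"
  assumes "is_basis e es"
    and "is_weight w"
  shows "partially_greedy w e es \<longleftrightarrow> quasi_greedy e es \<and> conservative w e"
proof -
  have "schauder_basis e" "biorthogonal e es" using assms(1) by (simp_all add: is_basis_def)
  then show ?thesis
    using assms(2) partially_greedy_imp_quasi_greedy partially_greedy_imp_conservative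
      quasi_greedy_conservative_imp_partially_greedy by blast
qed

end
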